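(* Let $K>0$ and let $\mathcal E_1=(Z_1,\sigma_1,\kappa_1)$, $\mathcal E_2=(Z_2,\sigma_2,\kappa_2)$ be objects of $\mathsf{SDS}_K$. The disjoint union $\mathcal E_1\sqcup\mathcal E_2$ satisfies the universal property of the coproduct in $\mathsf{SDS}_K$: the inclusions $i_1:\mathcal E_1\to\mathcal E_1\sqcup\mathcal E_2$ and $i_2:\mathcal E_2\to\mathcal E_1\sqcup\mathcal E_2$ are morphisms, and for all morphisms $f_1:\mathcal E_1\to\mathcal T$ and $f_2:\mathcal E_2\to\mathcal T$ with $\mathcal T\in\mathsf{SDS}_K$ there exists a unique morphism $h:\mathcal E_1\sqcup\mathcal E_2\to\mathcal T$ with $h|_{Z_1}=f_1$ and $h|_{Z_2}=f_2$.
   Context: A weighted dual skeleton is a triple $\mathcal E=(Z,\sigma,\kappa)$ where $Z$ is a non-empty finite set, $\sigma:Z\to Z$ satisfies $\sigma^2=\mathrm{id}$, and $\kappa:Z\to\mathbb R_{>0}$ satisfies $\kappa(z)\kappa(\sigma(z))=K$ for all $z\in Z$, with $K>0$ constant, called the degree. A morphism $\phi:(Z_1,\sigma_1,\kappa_1)\to(Z_2,\sigma_2,\kappa_2)$ is a map $\phi:Z_1\to Z_2$ with $\phi(\sigma_1(z))=\sigma_2(\phi(z))$ and $\kappa_1(z)=\kappa_2(\phi(z))$ for all $z\in Z_1$. $\mathsf{SDS}_K$ is the category of skeletons of degree $K$ with these morphisms. The disjoint union is $\mathcal E_1\sqcup\mathcal E_2=(Z_1\sqcup Z_2,\sigma_1\sqcup\sigma_2,\kappa_1\sqcup\kappa_2)$,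 the involution acting as $\sigma_i$ and the weight being $\kappa_i$ on $Z_i$. *)

theory Defs
  imports Complex_Main "HOL-Library.FuncSet"
begin

record 'a skeleton =
  points :: "'a set"
  invol :: "'a \<Rightarrow> 'a"
  weight :: "'a \<Rightarrow> real"

definition weighted_dual_skeleton :: "real \<Rightarrow> 'a skeleton \<Rightarrow> bool" where
  "weighted_dual_skeleton K E \<longleftrightarrow>
     K > 0 \<and> points E \<noteq> {} \<and> finite (points E) \<and>
     invol E \<in> points E \<rightarrow> points E \<and>
     (\<forall>z \<in> points E. invol E (invol E z) = z) \<and>
     (\<forall>z \<in> points E. weight E z > 0) \<and>
     (\<forall>z \<in> points E. weight E z * weight E (invol E z) = K)"

definition SDS :: "real \<Rightarrow> 'a skeleton set" where
  "SDS K = {E. weighted_dual_skeleton K E}"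

text \<open>
  Morphisms are extensional (\<open>undefined\<close> off the domain), so that equality of morphisms,
  and hence unique existence, means equality as maps on the underlying sets.
\<close>

definition Mor :: "'a skeleton \<Rightarrow> 'b skeleton \<Rightarrow> ('a \<Rightarrow> 'b) set" where
  "Mor E1 E2 = {\<phi> \<in> points E1 \<rightarrow>\<^sub>E points E2.
     \<forall>z \<in> points E1. \<phi> (invol E1 z) = invol E2 (\<phi> z) \<and> weight E1 z = weight E2 (\<phi> z)}"

definition disjoint_union :: "'a skeleton \<Rightarrow> 'b skeleton \<Rightarrow> ('a + 'b) skeleton"
    (infixr "\<squnion>\<^sub>S" 65) where
  "E1 \<squnion>\<^sub>S E2 =
     \<lparr>points = points E1 <+> points E2,
      invol = map_sum (invol E1) (invol E2),
      weight = case_sum (weight E1) (weight E2)\<rparr>"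

definition incl1 :: "'a skeleton \<Rightarrow> 'a \<Rightarrow> 'a + 'b" where
  "incl1 E1 = restrict Inl (points E1)"

definition incl2 :: "'b skeleton \<Rightarrow> 'b \<Rightarrow> 'a + 'b" where
  "incl2 E2 = restrict Inr (points E2)"

end

theory Submission imports Defs begin

text \<open>
  The involution and the weight of the disjoint union act on each summand separately, so the
  pointwise skeleton axioms and the morphism conditions hold on the union exactly when they hold on
  the two summands. The degree condition is the one place where the two objects must match: the
  product \<open>\<kappa>(z) \<kappa>(\<sigma>(z))\<close> is constant on the union because it has the same
  value on both summands.
  The universal property is therefore inherited from the coproduct of sets: the mediating map is
  the copairing \<open>case_sum f1 f2\<close>, which the splitting of the morphism conditions
  (\<open>Mor_disjoint_union_iff\<close>) makes a morphism, and it is unique because the two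
  inclusions cover the union.
\<close>

lemma disjoint_union_in_SDS:
  assumes "E1 \<in> SDS K" and "E2 \<in> SDS K"
  shows "E1 \<squnion>\<^sub>S E2 \<in> SDS K"
  using assms by (auto simp: SDS_def weighted_dual_skeleton_def disjoint_union_def)

lemma incl1_in_Mor:
  assumes "E1 \<in> SDS K"
  shows "incl1 E1 \<in> Mor E1 (E1 \<squnion>\<^sub>S E2)"
  using assms
  by (auto simp: SDS_def weighted_dual_skeleton_def Mor_def disjoint_union_def incl1_def)

lemma incl2_in_Mor:
  assumes "E2 \<in> SDS K"
  shows "incl2 E2 \<in> Mor E2 (E1 \<squnion>\<^sub>S E2)"
  using assms
  by (auto simp: SDS_def weighted_dual_skeleton_def Mor_def disjoint_union_def incl2_def)

text \<open>
  The equivalence is exact for extensional maps too: the points outside the union are those outside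
  one of the summands, so a map on the union takes the default value \<open>undefined\<close> there
  exactly when both of its components do so. Hence the copairing of two morphisms is a morphism
  as it stands, and uniqueness of \<open>h\<close> holds also off the points.
\<close>

lemma Mor_disjoint_union_iff:
  "h \<in> Mor (E1 \<squnion>\<^sub>S E2) T \<longleftrightarrow> h \<circ> Inl \<in> Mor E1 T \<and> h \<circ> Inr \<in> Mor E2 T"
proof -
  have PiE_Plus: "h \<in> (points E1 <+> points E2) \<rightarrow>\<^sub>E points T \<longleftrightarrow>
      h \<circ> Inl \<in> points E1 \<rightarrow>\<^sub>E points T \<and> h \<circ> Inr \<in> points E2 \<rightarrow>\<^sub>E points T"
    unfolding PiE_iff extensional_def by (simp add: split_sum_all Ball_def) blast
  show ?thesis
    unfolding Mor_def disjoint_union_def mem_Collect_eq skeleton.select_convs PiE_Plus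
    by (simp add: Ball_def split_sum_all) blast
qed

lemma compose_incl1:
  assumes "h \<in> Mor (E1 \<squnion>\<^sub>S E2) T"
  shows "compose (points E1) h (incl1 E1) = h \<circ> Inl"
proof -
  have "h \<circ> Inl \<in> extensional (points E1)"
    using assms[unfolded Mor_disjoint_union_iff] by (simp add: Mor_def PiE_iff)
  then show ?thesis
    by (auto simp: compose_def incl1_def extensional_def fun_eq_iff)
qed

lemma compose_incl2:
  assumes "h \<in> Mor (E1 \<squnion>\<^sub>S E2) T"
  shows "compose (points E2) h (incl2 E2) = h \<circ> Inr"
proof -
  have "h \<circ> Inr \<in> extensional (points E2)"
    using assms[unfolded Mor_disjoint_union_iff] by (simp add: Mor_def PiE_iff)
  then show ?thesis
    by (auto simp: compose_def incl2_def extensional_def fun_eq_iff)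
qed

lemma ex1_mediating_morphism:
  assumes "f1 \<in> Mor E1 T" and "f2 \<in> Mor E2 T"
  shows "\<exists>!h. h \<in> Mor (E1 \<squnion>\<^sub>S E2) T
      \<and> compose (points E1) h (incl1 E1) = f1
      \<and> compose (points E2) h (incl2 E2) = f2"
proof (rule ex1I[of _ "case_sum f1 f2"])
  have "case_sum f1 f2 \<in> Mor (E1 \<squnion>\<^sub>S E2) T"
    using assms by (simp add: Mor_disjoint_union_iff case_sum_o_inj)
  then show "case_sum f1 f2 \<in> Mor (E1 \<squnion>\<^sub>S E2) T
      \<and> compose (points E1) (case_sum f1 f2) (incl1 E1) = f1
      \<and> compose (points E2) (case_sum f1 f2) (incl2 E2) = f2"
    by (simp add: compose_incl1 compose_incl2 case_sum_o_inj)
next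
  fix h
  assume "h \<in> Mor (E1 \<squnion>\<^sub>S E2) T
      \<and> compose (points E1) h (incl1 E1) = f1
      \<and> compose (points E2) h (incl2 E2) = f2"
  then have "h \<circ> Inl = f1" and "h \<circ> Inr = f2"
    by (metis compose_incl1, metis compose_incl2)
  then show "h = case_sum f1 f2"
    by (auto simp: fun_eq_iff split: sum.split)
qed

theorem mainTheorem11:
  fixes K :: real and E1 :: "'a skeleton" and E2 :: "'b skeleton"
  assumes "K > 0" and "E1 \<in> SDS K" and "E2 \<in> SDS K"
  shows "E1 \<squnion>\<^sub>S E2 \<in> SDS K
    \<and> incl1 E1 \<in> Mor E1 (E1 \<squnion>\<^sub>S E2)
    \<and> incl2 E2 \<in> Mor E2 (E1 \<squnion>\<^sub>S E2)
    \<and> (\<forall>T :: 'c skeleton. T \<in> SDS K \<longrightarrow>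
         (\<forall>f1 \<in> Mor E1 T. \<forall>f2 \<in> Mor E2 T.
            \<exists>!h. h \<in> Mor (E1 \<squnion>\<^sub>S E2) T
              \<and> compose (points E1) h (incl1 E1) = f1
              \<and> compose (points E2) h (incl2 E2) = f2))"
  using disjoint_union_in_SDS[OF assms(2,3)] incl1_in_Mor[OF assms(2)] incl2_in_Mor[OF assms(3)]
    ex1_mediating_morphism
  by blast

end
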